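(* Let $\Delta t>0$ and let $(\hat f_h^{\mathfrak n})_{\mathfrak n\ge0}$ be the DLR-DG solution started from $\hat f_h^0$. Suppose that $$\|\varepsilon\hat f_h^0\|_{L^2(\Omega)}\le\|\varepsilon f_h^0\|_{L^2(\Omega)},$$ where $f_h^0\in V_h$ is defined by $(f_h^0,w_h;\varepsilon^2)_\Omega=(f_0,w_h;\varepsilon^2)_\Omega$ for all $w_h\in V_h$, with $f_0\in L^2(\Omega)$ the given initial datum. Then for all $\mathfrak n\ge0$ $$\|\varepsilon\hat f_h^{\mathfrak n+1}\|_{L^2(\Omega)}\le c^{\mathfrak n+1}\|\varepsilon f_0\|_{L^2(\Omega)}+\frac1{\chi_{\min}}\big(1-c^{\mathfrak n+1}\big)\|\varepsilon\eta\|_{L^2(\Omega)},\qquad c=\frac1{1+\Delta t\,\chi_{\min}}.$$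
   Context: Let $\varepsilon_{\max}>0$, $\Omega=\Omega_\mu\times\Omega_\varepsilon$ with $\Omega_\mu=[-1,1]\ni\mu$, $\Omega_\varepsilon=[0,\varepsilon_{\max}]\ni\varepsilon$. The weighted inner product is $(v,w;\varepsilon^2)_\Omega=\int_0^{\varepsilon_{\max}}\int_{-1}^1 vw\,\varepsilon^2\,d\mu\,d\varepsilon$, $\|\varepsilon w\|_{L^2(\Omega)}=(w,w;\varepsilon^2)_\Omega^{1/2}$, and $L^2(\Omega)$ is with respect to the measure $\varepsilon^2d\mu\,d\varepsilon$. The emissivity $\eta=\eta(\varepsilon)>0$, $\eta\in L^2(\Omega)$, and the opacity $\chi=\chi(\varepsilon)$ are given, with constants $0<\chi_{\min}\le\chi\le\chi_{\max}$. Set $\mathcal A(f,w)=(\eta,w;\varepsilon^2)_\Omega-(\chi f,w;\varepsilon^2)_\Omega$. Partition $\Omega_\mu$ and $\Omega_\varepsilon$ into $N_\mu$ and $N_\varepsilon$ intervals; $V_{\mu,h}$, $V_{\varepsilon,h}$ are the spaces of (discontinuous) piecewise polynomials of degree at most $k$ on these partitions, and $V_h=V_{\mu,h}\otimes V_{\varepsilon,h}$. Let $m=(k+1)N_\mu$, $n=(k+1)N_\varepsilon$, $1\le r\le\min\{m,n\}$. Let $\{x_i(\mu)\}_{i=1}^m$, $\{y_j(\varepsilon)\}_{j=1}^n$ be the bases of $V_{\mu,h}$, $V_{\varepsilon,h}$ consisting of Legendre polynomials supported on single cells and orthonormal in the unweighted $L^2$ inner product of the cell; $X=[x_1,\dots,x_m]^\top$,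 $Y=[y_1,\dots,y_n]^\top$; $A_{\boldsymbol 1}=[\int_{\Omega_\varepsilon}y_iy_j\varepsilon^2d\varepsilon]\in\mathbb R^{n\times n}$ (symmetric positive definite). DLR-DG scheme. $\hat f_h^{\mathfrak n}=X^\top U^{\mathfrak n}S^{\mathfrak n}(E^{\mathfrak n})^\top Y$ with $U^{\mathfrak n}\in\mathbb R^{m\times r}$, $S^{\mathfrak n}\in\mathbb R^{r\times r}$, $E^{\mathfrak n}\in\mathbb R^{n\times r}$, $(U^{\mathfrak n})^\top U^{\mathfrak n}=I_r=(E^{\mathfrak n})^\top A_{\boldsymbol 1}E^{\mathfrak n}$. With $V_1^{\mathfrak n}=\{X^\top\mathbf K(E^{\mathfrak n})^\top Y:\mathbf K\in\mathbb R^{m\times r}\}$, $V_2^{\mathfrak n}=\{X^\top U^{\mathfrak n}\mathbf L^\top Y:\mathbf L\in\mathbb R^{n\times r}\}$, find $f_{\mathbf K}=X^\top\mathbf K^{\mathfrak n+1}(E^{\mathfrak n})^\top Y\in V_1^{\mathfrak n}$ and $f_{\mathbf L}=X^\top U^{\mathfrak n}(\mathbf L^{\mathfrak n+1})^\top Y\in V_2^{\mathfrak n}$ with $\frac1{\Delta t}(f_{\mathbf K}-\hat f_h^{\mathfrak n},w_1;\varepsilon^2)_\Omega=\mathcal A(f_{\mathbf K},w_1)$ for all $w_1\in V_1^{\mathfrak n}$ and $\frac1{\Delta t}(f_{\mathbf L}-\hat f_h^{\mathfrak n},w_2;\varepsilon^2)_\Omega=\mathcal A(f_{\mathbf L},w_2)$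 for all $w_2\in V_2^{\mathfrak n}$; factor $\mathbf K^{\mathfrak n+1}=U^{\mathfrak n+1}R_{\mathbf K}$, $\mathbf L^{\mathfrak n+1}=E^{\mathfrak n+1}R_{\mathbf L}$ with $(U^{\mathfrak n+1})^\top U^{\mathfrak n+1}=I_r=(E^{\mathfrak n+1})^\top A_{\boldsymbol 1}E^{\mathfrak n+1}$ (any choice); set $V_0^{\mathfrak n+1}=\{X^\top U^{\mathfrak n+1}S(E^{\mathfrak n+1})^\top Y:S\in\mathbb R^{r\times r}\}$ and let $\hat f_h^{\mathfrak n+1}=X^\top U^{\mathfrak n+1}S^{\mathfrak n+1}(E^{\mathfrak n+1})^\top Y\in V_0^{\mathfrak n+1}$ be the (unique) solution of $\frac1{\Delta t}(\hat f_h^{\mathfrak n+1}-\hat f_h^{\mathfrak n},w_0;\varepsilon^2)_\Omega=\mathcal A(\hat f_h^{\mathfrak n+1},w_0)$ for all $w_0\in V_0^{\mathfrak n+1}$. *)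

theory Defs
  imports "HOL-Analysis.Analysis" "HOL-Computational_Algebra.Polynomial"
    "Jordan_Normal_Form.Matrix"
begin

hide_const (open) Finite_Cartesian_Product.vec
hide_type (open) Finite_Cartesian_Product.vec
no_notation Finite_Cartesian_Product.vec_nth (infixl \<open>$\<close> 90)

text \<open>
  Points of the phase space are pairs (\<mu>, \<epsilon>). The weight \<epsilon>^2 is part of the measure, so that the
  inner product below is, by Fubini, the iterated integral of v w \<epsilon>^2 over \<mu> in [-1,1] and \<epsilon> in
  [0,emax].
\<close>

definition Omega :: "real \<Rightarrow> (real \<times> real) set" where
  "Omega emax = {-1..1} \<times> {0..emax}"

definition Omega_measure :: "real \<Rightarrow> (real \<times> real) measure" where
  "Omega_measure emax = density (lebesgue_on (Omega emax)) (\<lambda>(\<mu>, \<epsilon>). ennreal (\<epsilon>\<^sup>2))"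

definition L2_Omega :: "real \<Rightarrow> (real \<times> real \<Rightarrow> real) set" where
  "L2_Omega emax = {w. w \<in> borel_measurable (Omega_measure emax) \<and>
     integrable (Omega_measure emax) (\<lambda>z. (w z)\<^sup>2)}"

definition winner :: "real \<Rightarrow> (real \<times> real \<Rightarrow> real) \<Rightarrow> (real \<times> real \<Rightarrow> real) \<Rightarrow> real" where
  "winner emax v w = (\<integral>z. v z * w z \<partial>Omega_measure emax)"

text \<open>The norm of \<epsilon>w in the unweighted space, that is, of w in the weighted one.\<close>

definition wnorm :: "real \<Rightarrow> (real \<times> real \<Rightarrow> real) \<Rightarrow> real" where
  "wnorm emax w = sqrt (winner emax w w)"

definition energy_fun :: "(real \<Rightarrow> real) \<Rightarrow> real \<times> real \<Rightarrow> real" where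
  "energy_fun g = (\<lambda>(\<mu>, \<epsilon>). g \<epsilon>)"

definition coll_form :: "real \<Rightarrow> (real \<Rightarrow> real) \<Rightarrow> (real \<Rightarrow> real) \<Rightarrow>
    (real \<times> real \<Rightarrow> real) \<Rightarrow> (real \<times> real \<Rightarrow> real) \<Rightarrow> real" where
  "coll_form emax eta chi f w =
     winner emax (energy_fun eta) w - winner emax (\<lambda>z. energy_fun chi z * f z) w"

definition is_partition :: "real \<Rightarrow> real \<Rightarrow> nat \<Rightarrow> (nat \<Rightarrow> real) \<Rightarrow> bool" where
  "is_partition a b N p \<longleftrightarrow> p 0 = a \<and> p N = b \<and> (\<forall>c<N. p c < p (Suc c))"

text \<open>
  Discontinuous piecewise polynomials: nothing is required at the nodes (a null set) or outside
  the partitioned interval.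
\<close>

definition pw_poly :: "nat \<Rightarrow> nat \<Rightarrow> (nat \<Rightarrow> real) \<Rightarrow> (real \<Rightarrow> real) set" where
  "pw_poly k N p = {v. \<forall>c<N. \<exists>q :: real poly. degree q \<le> k \<and>
     (\<forall>x\<in>{p c<..<p (Suc c)}. v x = poly q x)}"

definition tensor_space ::
    "(real \<Rightarrow> real) set \<Rightarrow> (real \<Rightarrow> real) set \<Rightarrow> (real \<times> real \<Rightarrow> real) set" where
  "tensor_space V W = {(\<lambda>(\<mu>, \<epsilon>). \<Sum>l<s. v l \<mu> * w l \<epsilon>) | (s :: nat) v w.
     (\<forall>l<s. v l \<in> V \<and> w l \<in> W)}"

text \<open>Rodrigues' formula.\<close>

definition legendre :: "nat \<Rightarrow> real poly" where
  "legendre d = Polynomial.smult (1 / (2 ^ d * fact d)) ((pderiv ^^ d) ([:-1, 0, 1:] ^ d))"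

text \<open>
  The basis function number c(k+1)+d (counted from 0) is the Legendre polynomial of degree d
  transplanted from [-1,1] to the cell number c; the square root normalises it in the unweighted
  inner product of that cell.
\<close>

definition dg_basis :: "nat \<Rightarrow> (nat \<Rightarrow> real) \<Rightarrow> nat \<Rightarrow> real \<Rightarrow> real" where
  "dg_basis k p i x =
     (let c = i div (k + 1); d = i mod (k + 1); a = p c; b = p (Suc c)
      in if a < x \<and> x < b
         then sqrt ((2 * real d + 1) / (b - a)) * poly (legendre d) ((2 * x - a - b) / (b - a))
         else 0)"

definition dg_basis_vec :: "nat \<Rightarrow> nat \<Rightarrow> (nat \<Rightarrow> real) \<Rightarrow> real \<Rightarrow> real vec" where
  "dg_basis_vec k N p x = Matrix.vec ((k + 1) * N) (\<lambda>i. dg_basis k p i x)"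

text \<open>The function X^T M Y with coefficient matrix M.\<close>

definition coeff_fun ::
    "(real \<Rightarrow> real vec) \<Rightarrow> (real \<Rightarrow> real vec) \<Rightarrow> real mat \<Rightarrow> real \<times> real \<Rightarrow> real" where
  "coeff_fun X Y M = (\<lambda>(\<mu>, \<epsilon>). scalar_prod (X \<mu>) (M *\<^sub>v Y \<epsilon>))"

definition weighted_mass :: "real \<Rightarrow> nat \<Rightarrow> (real \<Rightarrow> real vec) \<Rightarrow> real mat" where
  "weighted_mass emax n Y =
     mat n n (\<lambda>(i, j). \<integral>\<epsilon>. Y \<epsilon> $ i * Y \<epsilon> $ j * \<epsilon>\<^sup>2 \<partial>lebesgue_on {0..emax})"

definition orthonormal_factors ::
    "real \<Rightarrow> nat \<Rightarrow> nat \<Rightarrow> nat \<Rightarrow> (real \<Rightarrow> real vec) \<Rightarrow> real mat \<Rightarrow> real mat \<Rightarrow> bool" where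
  "orthonormal_factors emax m n r Y U E \<longleftrightarrow>
     U \<in> carrier_mat m r \<and> E \<in> carrier_mat n r \<and>
     transpose_mat U * U = 1\<^sub>m r \<and>
     transpose_mat E * weighted_mass emax n Y * E = 1\<^sub>m r"

definition V1 :: "nat \<Rightarrow> nat \<Rightarrow> (real \<Rightarrow> real vec) \<Rightarrow> (real \<Rightarrow> real vec) \<Rightarrow> real mat \<Rightarrow>
    (real \<times> real \<Rightarrow> real) set" where
  "V1 m r X Y E = {coeff_fun X Y (K * transpose_mat E) | K. K \<in> carrier_mat m r}"

definition V2 :: "nat \<Rightarrow> nat \<Rightarrow> (real \<Rightarrow> real vec) \<Rightarrow> (real \<Rightarrow> real vec) \<Rightarrow> real mat \<Rightarrow>
    (real \<times> real \<Rightarrow> real) set" where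
  "V2 n r X Y U = {coeff_fun X Y (U * transpose_mat L) | L. L \<in> carrier_mat n r}"

definition V0 :: "nat \<Rightarrow> (real \<Rightarrow> real vec) \<Rightarrow> (real \<Rightarrow> real vec) \<Rightarrow> real mat \<Rightarrow> real mat \<Rightarrow>
    (real \<times> real \<Rightarrow> real) set" where
  "V0 r X Y U E = {coeff_fun X Y (U * S * transpose_mat E) | S. S \<in> carrier_mat r r}"

text \<open>
  One implicit Euler step from g to f, Galerkin-discretised in the space V.
\<close>

definition euler_galerkin :: "real \<Rightarrow> (real \<Rightarrow> real) \<Rightarrow> (real \<Rightarrow> real) \<Rightarrow> real \<Rightarrow>
    (real \<times> real \<Rightarrow> real) set \<Rightarrow> (real \<times> real \<Rightarrow> real) \<Rightarrow> (real \<times> real \<Rightarrow> real) \<Rightarrow> bool" where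
  "euler_galerkin emax eta chi \<Delta>t V g f \<longleftrightarrow>
     f \<in> V \<and> (\<forall>w\<in>V. 1 / \<Delta>t * winner emax (\<lambda>z. f z - g z) w = coll_form emax eta chi f w)"

text \<open>
  The factors R_K, R_L are arbitrary square matrices, so every admissible orthonormal
  factorisation of K and L is covered, also when K or L is rank deficient.
\<close>

definition dlr_dg_step :: "real \<Rightarrow> (real \<Rightarrow> real) \<Rightarrow> (real \<Rightarrow> real) \<Rightarrow> real \<Rightarrow> nat \<Rightarrow> nat \<Rightarrow> nat \<Rightarrow>
    (real \<Rightarrow> real vec) \<Rightarrow> (real \<Rightarrow> real vec) \<Rightarrow>
    real mat \<Rightarrow> real mat \<Rightarrow> real mat \<Rightarrow> real mat \<Rightarrow> real mat \<Rightarrow> real mat \<Rightarrow> bool" where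
  "dlr_dg_step emax eta chi \<Delta>t m n r X Y U S E U' S' E' \<longleftrightarrow>
     (let f = coeff_fun X Y (U * S * transpose_mat E) in
      (\<exists>K \<in> carrier_mat m r. \<exists>L \<in> carrier_mat n r.
       \<exists>R\<^sub>K \<in> carrier_mat r r. \<exists>R\<^sub>L \<in> carrier_mat r r.
         euler_galerkin emax eta chi \<Delta>t (V1 m r X Y E) f (coeff_fun X Y (K * transpose_mat E)) \<and>
         euler_galerkin emax eta chi \<Delta>t (V2 n r X Y U) f (coeff_fun X Y (U * transpose_mat L)) \<and>
         K = U' * R\<^sub>K \<and> L = E' * R\<^sub>L) \<and>
      orthonormal_factors emax m n r Y U' E' \<and>
      S' \<in> carrier_mat r r \<and>
      euler_galerkin emax eta chi \<Delta>t (V0 r X Y U' E') f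
        (coeff_fun X Y (U' * S' * transpose_mat E')))"

definition dlr_dg_solution :: "real \<Rightarrow> (real \<Rightarrow> real) \<Rightarrow> (real \<Rightarrow> real) \<Rightarrow> real \<Rightarrow> nat \<Rightarrow> nat \<Rightarrow> nat \<Rightarrow>
    (real \<Rightarrow> real vec) \<Rightarrow> (real \<Rightarrow> real vec) \<Rightarrow>
    (nat \<Rightarrow> real mat) \<Rightarrow> (nat \<Rightarrow> real mat) \<Rightarrow> (nat \<Rightarrow> real mat) \<Rightarrow> bool" where
  "dlr_dg_solution emax eta chi \<Delta>t m n r X Y U S E \<longleftrightarrow>
     orthonormal_factors emax m n r Y (U 0) (E 0) \<and> S 0 \<in> carrier_mat r r \<and>
     (\<forall>t. dlr_dg_step emax eta chi \<Delta>t m n r X Y (U t) (S t) (E t)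
            (U (Suc t)) (S (Suc t)) (E (Suc t)))"

end

theory Submission
  imports Defs
begin

text \<open>
  The stability bound is an energy argument for the last substep. The new iterate lies in the
  Galerkin space in which it is sought, so it may be tested with itself. Writing
  \<open>\<parallel>\<cdot>\<parallel>\<close> for the weighted norm, bounding the opacity below by \<open>chi_min\<close> and applying
  Cauchy--Schwarz to the two remaining terms gives
  \<open>(1 + \<Delta>t * chi_min) * \<parallel>f'\<parallel> \<le> \<parallel>f\<parallel> + \<Delta>t * \<parallel>eta\<parallel>\<close> for the step from \<open>f\<close> to \<open>f'\<close>
  (\<open>euler_galerkin_wnorm_le\<close>). The last substep starts from the old iterate itself and not
  from its projection to the new space, so no truncation error enters, whatever the new bases.

  The recursion is solved as a geometric sum (\<open>implicit_euler_recursion\<close>), and the initial norm is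
  controlled because \<open>fh0\<close> is an orthogonal projection of \<open>f0\<close>
  (\<open>wnorm_projection_le\<close>).

  The analytic content is the integrability of the products above: a Bochner integral of a
  non-integrable function is 0, so the estimates fail without it. The discrete functions are square-integrable because piecewise polynomials agree almost
  everywhere with bounded Borel functions (\<open>tensor_space_subset_L2_Omega\<close>), and multiplication by
  the opacity preserves square-integrability (\<open>L2_Omega_bounded_mult\<close>, \<open>energy_fun_measurable\<close>).
\<close>

section \<open>Null sets and measurability on the phase space\<close>

text \<open>
  A null set times the real line is null in the plane. This transfers statements about functions
  of one variable to the phase space.
\<close>

lemma AE_lborel_fst:
  assumes "AE x in (lborel :: real measure). P x"
  shows "AE z in (lborel :: (real \<times> real) measure). P (fst z)"
proof -
  obtain N where N: "N \<in> sets lborel" "emeasure (lborel :: real measure) N = 0" "{x. \<not> P x} \<subseteq> N"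
    using AE_E[OF assms] by (metis (no_types, lifting) UNIV_I space_lborel space_borel Collect_cong)
  have "N \<times> UNIV \<in> null_sets (lborel \<Otimes>\<^sub>M lborel :: (real \<times> real) measure)"
    using N(1,2) lborel.emeasure_pair_measure_Times[of N lborel UNIV] by (auto simp: null_sets_def)
  then have "N \<times> UNIV \<in> null_sets (lborel :: (real \<times> real) measure)"
    by (simp add: lborel_prod)
  then show ?thesis
    using N(3) by (intro AE_I'[of "N \<times> UNIV"]) auto
qed

lemma AE_lborel_snd:
  assumes "AE x in (lborel :: real measure). P x"
  shows "AE z in (lborel :: (real \<times> real) measure). P (snd z)"
proof -
  obtain N where N: "N \<in> sets lborel" "emeasure (lborel :: real measure) N = 0" "{x. \<not> P x} \<subseteq> N"
    using AE_E[OF assms] by (metis (no_types, lifting) UNIV_I space_lborel space_borel Collect_cong)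
  have "UNIV \<times> N \<in> null_sets (lborel \<Otimes>\<^sub>M lborel :: (real \<times> real) measure)"
    using N(1,2) lborel.emeasure_pair_measure_Times[of UNIV lborel N] by (auto simp: null_sets_def)
  then have "UNIV \<times> N \<in> null_sets (lborel :: (real \<times> real) measure)"
    by (simp add: lborel_prod)
  then show ?thesis
    using N(3) by (intro AE_I'[of "UNIV \<times> N"]) auto
qed

text \<open>
  Completeness of the measure: preimages under the two functions differ by a subset of a null set.
\<close>

lemma measurable_completion_AE_cong:
  assumes g: "g \<in> measurable (completion M) N"
    and eq: "AE x in M. f x = g x" and f: "f \<in> space M \<rightarrow> space N"
  shows "f \<in> measurable (completion M) N"
proof (rule measurableI)
  fix A assume A: "A \<in> sets N"
  have same: "AE x in completion M. x \<in> g -` A \<inter> space M \<longleftrightarrow> x \<in> f -` A \<inter> space M"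
    using AE_completion[OF eq] by eventually_elim auto
  have "g -` A \<inter> space M \<in> sets (completion M)"
    using measurable_sets[OF g A] by simp
  from completion.in_sets_AE[OF same this] show "f -` A \<inter> space (completion M) \<in> sets (completion M)"
    by simp
qed (use f in auto)

lemma Omega_borel: "Omega emax \<in> sets borel"
  unfolding Omega_def by (intro borel_closed closed_Times) auto

lemma Omega_lebesgue: "Omega emax \<in> sets lebesgue"
  using Omega_borel[of emax] by auto

lemma weight_measurable:
  "(\<lambda>(\<mu> :: real, \<epsilon>). ennreal (\<epsilon>\<^sup>2)) \<in> borel_measurable (lebesgue_on (Omega emax))"
proof -
  have "(\<lambda>(\<mu> :: real, \<epsilon>). ennreal (\<epsilon>\<^sup>2)) \<in> borel_measurable borel"
    by (simp add: case_prod_beta borel_measurable_continuous_onI continuous_intros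
        flip: borel_prod)
  then show ?thesis
    by (intro measurable_restrict_space1 measurable_completion) simp
qed

lemma space_Omega_measure [simp]: "space (Omega_measure emax) = Omega emax"
  by (simp add: Omega_measure_def)

lemma borel_measurable_Omega_measure_iff:
  "f \<in> borel_measurable (Omega_measure emax) \<longleftrightarrow> f \<in> borel_measurable (lebesgue_on (Omega emax))"
  by (simp add: Omega_measure_def)

lemma AE_Omega_measure:
  assumes "AE z in lborel. z \<in> Omega emax \<longrightarrow> P z"
  shows "AE z in Omega_measure emax. P z"
proof -
  have "AE z in lebesgue_on (Omega emax). P z"
    using AE_completion[OF assms] Omega_lebesgue by (simp add: AE_restrict_space_iff)
  then show ?thesis
    unfolding Omega_measure_def AE_density[OF weight_measurable] by auto
qed

text \<open>
  A piecewise polynomial is arbitrary at the nodes, and an opacity is only Lebesgue measurable in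
  the energy variable. Both become measurable on the phase space through a Borel function with
  which they agree almost everywhere.
\<close>

lemma borel_measurable_Omega_measure_AE:
  fixes f g :: "real \<times> real \<Rightarrow> real"
  assumes g: "g \<in> borel_measurable borel"
    and eq: "AE z in lborel. z \<in> Omega emax \<longrightarrow> f z = g z"
  shows "f \<in> borel_measurable (Omega_measure emax)"
proof -
  let ?r = "\<lambda>h z. if z \<in> Omega emax then h z else (0 :: real)"
  have "?r g \<in> borel_measurable lborel"
    using g Omega_borel[of emax] by simp
  then have "?r g \<in> borel_measurable lebesgue"
    by (rule measurable_completion)
  moreover have "AE z in lborel. ?r f z = ?r g z"
    using eq by eventually_elim simp
  ultimately have "?r f \<in> borel_measurable lebesgue"
    by (rule measurable_completion_AE_cong) simp
  then show ?thesis
    unfolding borel_measurable_Omega_measure_iff by (rule borel_measurable_if_D)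
qed

text \<open>
  The weight is at most \<open>emax\<^sup>2\<close> on the bounded set \<open>Omega emax\<close>. Finiteness makes bounded
  measurable functions square-integrable.
\<close>

lemma finite_measure_Omega_measure: "finite_measure (Omega_measure emax)"
proof (rule finite_measureI)
  have "emeasure (Omega_measure emax) (Omega emax) =
      (\<integral>\<^sup>+z. (case z of (\<mu>, \<epsilon>) \<Rightarrow> ennreal (\<epsilon>\<^sup>2)) \<partial>lebesgue_on (Omega emax))"
    unfolding Omega_measure_def
    by (subst emeasure_density[OF weight_measurable]) (auto intro!: nn_integral_cong)
  also have "\<dots> \<le> (\<integral>\<^sup>+z. ennreal (emax\<^sup>2) \<partial>lebesgue_on (Omega emax))"
    by (intro nn_integral_mono) (auto simp: Omega_def intro!: ennreal_leI power_mono)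
  also have "\<dots> = ennreal (emax\<^sup>2) * emeasure lebesgue (Omega emax)"
    using Omega_lebesgue by (simp add: emeasure_restrict_space)
  also have "\<dots> < \<infinity>"
  proof -
    have "bounded (Omega emax)"
      unfolding Omega_def by (intro bounded_Times) auto
    then have "emeasure lebesgue (Omega emax) < \<infinity>"
      using emeasure_bounded_finite[of "Omega emax"] Omega_borel[of emax] by simp
    then show ?thesis
      by (simp add: ennreal_mult_less_top)
  qed
  finally show "emeasure (Omega_measure emax) (space (Omega_measure emax)) \<noteq> \<infinity>"
    by simp
qed

section \<open>The weighted space of square-integrable functions\<close>

lemma L2_OmegaD:
  assumes "f \<in> L2_Omega emax"
  shows "f \<in> borel_measurable (Omega_measure emax)"
    and "integrable (Omega_measure emax) (\<lambda>z. (f z)\<^sup>2)"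
  using assms by (auto simp: L2_Omega_def)

text \<open>
  The product is dominated by the sum of the squares.
\<close>

lemma integrable_mult_L2_Omega:
  assumes "f \<in> L2_Omega emax" "g \<in> L2_Omega emax"
  shows "integrable (Omega_measure emax) (\<lambda>z. f z * g z)"
proof (rule Bochner_Integration.integrable_bound)
  show "integrable (Omega_measure emax) (\<lambda>z. (f z)\<^sup>2 + (g z)\<^sup>2)"
    using assms by (intro Bochner_Integration.integrable_add L2_OmegaD)
  show "(\<lambda>z. f z * g z) \<in> borel_measurable (Omega_measure emax)"
    using assms L2_OmegaD(1) by (intro borel_measurable_times) auto
  have "\<bar>x * y\<bar> \<le> x\<^sup>2 + y\<^sup>2" for x y :: real
    using sum_squares_bound[of "\<bar>x\<bar>" "\<bar>y\<bar>"] mult_nonneg_nonneg[of "\<bar>x\<bar>" "\<bar>y\<bar>"]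
    unfolding abs_mult power2_abs by linarith
  then show "AE z in Omega_measure emax. norm (f z * g z) \<le> norm ((f z)\<^sup>2 + (g z)\<^sup>2)"
    by (intro AE_I2) (auto intro: order_trans)
qed

lemma winner_diff_left:
  assumes "f \<in> L2_Omega emax" "g \<in> L2_Omega emax" "w \<in> L2_Omega emax"
  shows "winner emax (\<lambda>z. f z - g z) w = winner emax f w - winner emax g w"
  unfolding winner_def using assms integrable_mult_L2_Omega
  by (simp add: left_diff_distrib)

lemma winner_self_nonneg: "0 \<le> winner emax f f"
  unfolding winner_def by (intro integral_nonneg_AE) auto

lemma wnorm_nonneg: "0 \<le> wnorm emax f"
  unfolding wnorm_def by (simp add: winner_self_nonneg)

lemma wnorm_square: "(wnorm emax f)\<^sup>2 = winner emax f f"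
  unfolding wnorm_def by (simp add: winner_self_nonneg)

text \<open>
  Cauchy--Schwarz, from the non-negativity of the square integral of \<open>a * f - b * g\<close>.
\<close>

lemma winner_le_wnorm:
  assumes f: "f \<in> L2_Omega emax" and g: "g \<in> L2_Omega emax"
  shows "winner emax f g \<le> wnorm emax f * wnorm emax g"
proof -
  have quadratic: "0 \<le> a\<^sup>2 * winner emax f f - 2 * a * b * winner emax f g + b\<^sup>2 * winner emax g g" for a b
  proof -
    have "0 \<le> (\<integral>z. (a * f z - b * g z)\<^sup>2 \<partial>Omega_measure emax)"
      by (intro integral_nonneg_AE) auto
    also have "\<dots> = (\<integral>z. a\<^sup>2 * (f z * f z) - 2 * a * b * (f z * g z) + b\<^sup>2 * (g z * g z)
        \<partial>Omega_measure emax)"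
      by (intro Bochner_Integration.integral_cong) (auto simp: power2_eq_square algebra_simps)
    also have "\<dots> = a\<^sup>2 * winner emax f f - 2 * a * b * winner emax f g + b\<^sup>2 * winner emax g g"
      unfolding winner_def using f g integrable_mult_L2_Omega by simp
    finally show ?thesis .
  qed
  let ?F = "wnorm emax f" and ?G = "wnorm emax g" and ?I = "winner emax f g"
  have Q: "2 * a * b * ?I \<le> (a * ?F)\<^sup>2 + (b * ?G)\<^sup>2" for a b
    using quadratic[of a b] by (simp add: power_mult_distrib wnorm_square)
  show ?thesis
  proof (cases "?F = 0 \<or> ?G = 0")
    case False
    \<comment> \<open>The choice \<open>a = ?G\<close>, \<open>b = ?F\<close> balances the two squares.\<close>
    then have pos: "0 < ?F * ?G"
      using wnorm_nonneg by (metis less_eq_real_def mult_pos_pos)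
    have "(?F * ?G) * ?I \<le> (?F * ?G) * (?F * ?G)"
      using Q[of ?G ?F] by (simp add: power2_eq_square algebra_simps)
    then show ?thesis
      using pos by (rule mult_left_le_imp_le)
  next
    case True
    \<comment> \<open>One square vanishes, so its free coefficient can be scaled until \<open>2 * a * b * ?I\<close>
      exceeds the square that remains.\<close>
    have "?I \<le> 0"
    proof (rule ccontr)
      assume "\<not> ?I \<le> 0"
      then have I: "?I > 0" by simp
      from True show False
      proof
        assume "?F = 0"
        then show False
          using Q[of "(?G\<^sup>2 + 1) / (2 * ?I)" 1] I by simp
      next
        assume "?G = 0"
        then show False
          using Q[of 1 "(?F\<^sup>2 + 1) / (2 * ?I)"] I by simp
      qed
    qed
    then show ?thesis
      using True by auto
  qed
qed

lemma L2_Omega_bounded_AE: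
  assumes g: "g \<in> borel_measurable borel" and bound: "\<And>z. \<bar>g z\<bar> \<le> B"
    and eq: "AE z in lborel. z \<in> Omega emax \<longrightarrow> f z = g z"
  shows "f \<in> L2_Omega emax"
proof -
  have f: "f \<in> borel_measurable (Omega_measure emax)"
    using g eq by (rule borel_measurable_Omega_measure_AE)
  have "norm ((f z)\<^sup>2) \<le> B\<^sup>2" if "f z = g z" for z
    using that power_mono[OF bound[of z], of 2] by simp
  then have "AE z in Omega_measure emax. norm ((f z)\<^sup>2) \<le> B\<^sup>2"
    using AE_Omega_measure[OF eq] by (auto elim!: eventually_mono)
  then have "integrable (Omega_measure emax) (\<lambda>z. (f z)\<^sup>2)"
    using f finite_measure_Omega_measure by (intro finite_measure.integrable_const_bound) auto
  with f show ?thesis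
    by (simp add: L2_Omega_def)
qed

lemma L2_Omega_bounded_mult:
  assumes h: "h \<in> borel_measurable (Omega_measure emax)"
    and bound: "\<And>z. z \<in> Omega emax \<Longrightarrow> \<bar>h z\<bar> \<le> B"
    and f: "f \<in> L2_Omega emax"
  shows "(\<lambda>z. h z * f z) \<in> L2_Omega emax"
proof -
  have meas: "(\<lambda>z. h z * f z) \<in> borel_measurable (Omega_measure emax)"
    using h L2_OmegaD(1)[OF f] by simp
  have square_bound: "(h z * f z)\<^sup>2 \<le> B\<^sup>2 * (f z)\<^sup>2" if "z \<in> Omega emax" for z
    using power_mono[OF bound[OF that], of 2] by (simp add: power_mult_distrib mult_right_mono)
  have "integrable (Omega_measure emax) (\<lambda>z. (h z * f z)\<^sup>2)"
  proof (rule Bochner_Integration.integrable_bound)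
    show "integrable (Omega_measure emax) (\<lambda>z. B\<^sup>2 * (f z)\<^sup>2)"
      using L2_OmegaD(2)[OF f] by simp
    show "(\<lambda>z. (h z * f z)\<^sup>2) \<in> borel_measurable (Omega_measure emax)"
      using meas by (rule borel_measurable_power)
    show "AE z in Omega_measure emax. norm ((h z * f z)\<^sup>2) \<le> norm (B\<^sup>2 * (f z)\<^sup>2)"
      using square_bound by (intro AE_I2) simp
  qed
  with meas show ?thesis
    by (simp add: L2_Omega_def)
qed

text \<open>
  Borel measurability of the projection to the energy variable handles compositions with Borel
  functions only, so the Lebesgue measurable \<open>chi\<close> is first replaced by a Borel version. The
  exceptional null set pulls back to a null set of the plane.
\<close>

lemma energy_fun_measurable:
  assumes chi: "chi \<in> borel_measurable (lebesgue_on {0..emax})"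
  shows "energy_fun chi \<in> borel_measurable (Omega_measure emax)"
proof -
  have "(\<lambda>x. if x \<in> {0..emax} then chi x else 0) \<in> borel_measurable lebesgue"
    using chi by (intro borel_measurable_if_I) auto
  then obtain g where g: "g \<in> borel_measurable (lborel :: real measure)"
    and eq: "AE x in lborel. (if x \<in> {0..emax} then chi x else 0) = g x"
    using completion_ex_borel_measurable_real by blast
  have "(\<lambda>z :: real \<times> real. g (snd z)) \<in> borel_measurable borel"
    using g by (simp flip: borel_prod)
  moreover have "AE z in lborel. z \<in> Omega emax \<longrightarrow> energy_fun chi z = g (snd z)"
    using AE_lborel_snd[OF eq] by eventually_elim (auto simp: Omega_def energy_fun_def)
  ultimately show ?thesis
    by (rule borel_measurable_Omega_measure_AE)
qed

section \<open>Piecewise polynomials and the finite element spaces\<close>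

text \<open>
  Nothing is required of \<open>u\<close> outside \<open>I\<close>, because a piecewise polynomial is arbitrary outside the
  partitioned interval, whereas \<open>g\<close> is measurable and bounded globally.
\<close>

definition bounded_borel_version ::
    "real set \<Rightarrow> (real \<Rightarrow> real) \<Rightarrow> (real \<Rightarrow> real) \<Rightarrow> real \<Rightarrow> bool" where
  "bounded_borel_version I u g B \<longleftrightarrow> g \<in> borel_measurable borel \<and> (\<forall>x. \<bar>g x\<bar> \<le> B) \<and>
     (AE x in lborel. x \<in> I \<longrightarrow> u x = g x)"

lemma bounded_borel_versionD:
  assumes "bounded_borel_version I u g B"
  shows "g \<in> borel_measurable borel" "\<bar>g x\<bar> \<le> B" "AE x in lborel. x \<in> I \<longrightarrow> u x = g x"
  using assms by (simp_all only: bounded_borel_version_def)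

text \<open>
  Setting the function to 0 at the finitely many nodes and outside the partitioned interval changes
  it on a null set of the interval only.
\<close>

lemma pw_poly_bounded_borel:
  assumes p: "is_partition a b N p" and v: "v \<in> pw_poly k N p"
  shows "\<exists>g B. bounded_borel_version {a..b} v g B"
proof -
  have "\<forall>c<N. \<exists>q. \<forall>x\<in>{p c<..<p (Suc c)}. v x = poly q x"
    using v unfolding pw_poly_def by blast
  then obtain q where q: "\<And>c x. c < N \<Longrightarrow> x \<in> {p c<..<p (Suc c)} \<Longrightarrow> v x = poly (q c) x"
    by metis
  let ?I = "\<lambda>c. {p c<..<p (Suc c)}"
  define g where "g x = (if \<exists>c<N. x \<in> ?I c then v x else 0)" for x
  have cover: "x \<in> {p 0..p M} \<Longrightarrow> x \<in> p ` {..M} \<or> (\<exists>c<M. x \<in> ?I c)" for M x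
  proof (induction M)
    case (Suc M)
    show ?case
    proof (cases "x \<le> p M")
      case True
      then show ?thesis using Suc by (force simp: less_Suc_eq)
    next
      case False
      then show ?thesis using Suc.prems by (cases "x = p (Suc M)") (auto intro!: exI[of _ M])
    qed
  qed auto
  have g_borel: "g \<in> borel_measurable borel"
  proof -
    \<comment> \<open>Adding one cell at a time presents \<open>g\<close> as a finite case distinction between polynomials.\<close>
    define h where "h = rec_nat (\<lambda>x. 0 :: real) (\<lambda>c h x. if x \<in> ?I c then poly (q c) x else h x)"
    have h_meas: "h M \<in> borel_measurable borel" for M
    proof (induction M)
      case (Suc M)
      have "(\<lambda>x. poly (q M) x) \<in> borel_measurable borel"
        by (intro borel_measurable_continuous_onI continuous_intros)
      then show ?case using Suc by (simp add: h_def)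
    qed (simp add: h_def)
    have "M \<le> N \<Longrightarrow> h M x = (if \<exists>c<M. x \<in> ?I c then v x else 0)" for M x
    proof (induction M)
      case (Suc M)
      then have "x \<in> ?I M \<Longrightarrow> v x = poly (q M) x"
        using q[of M x] by simp
      then show ?case
        using Suc by (auto simp: h_def less_Suc_eq)
    qed (simp add: h_def)
    then have "g = h N"
      by (auto simp: g_def fun_eq_iff)
    with h_meas show ?thesis by simp
  qed
  have "\<exists>B. \<forall>x\<in>?I c. \<bar>poly (q c) x\<bar> \<le> B" for c
  proof -
    have "bounded (poly (q c) ` {p c..p (Suc c)})"
      by (intro compact_imp_bounded compact_continuous_image continuous_intros) auto
    then show ?thesis
      by (force simp: bounded_iff)
  qed
  then obtain B where B: "\<And>c x. x \<in> ?I c \<Longrightarrow> \<bar>poly (q c) x\<bar> \<le> B c"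
    by metis
  have bound: "\<bar>g x\<bar> \<le> (\<Sum>c<N. \<bar>B c\<bar>)" for x
  proof (cases "\<exists>c<N. x \<in> ?I c")
    case True
    then obtain c where c: "c < N" "x \<in> ?I c" by blast
    then have "\<bar>g x\<bar> \<le> \<bar>B c\<bar>"
      using B[of x c] q[of c x] by (auto simp: g_def)
    also have "\<dots> \<le> (\<Sum>c<N. \<bar>B c\<bar>)"
      using c(1) by (intro member_le_sum) auto
    finally show ?thesis .
  qed (auto simp: g_def intro!: sum_nonneg)
  have "AE x in lborel. x \<notin> p ` {..N}"
    by (intro AE_not_in countable_imp_null_set_lborel) auto
  then have "AE x in lborel. x \<in> {a..b} \<longrightarrow> v x = g x"
    using p cover[of _ N] by (auto simp: is_partition_def g_def elim!: eventually_mono)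
  with g_borel bound show ?thesis
    unfolding bounded_borel_version_def by blast
qed

text \<open>
  The bounded Borel versions of the factors combine to one of the tensor product, because each
  exceptional set of one variable is null on the phase space as well.
\<close>

lemma tensor_space_subset_L2_Omega:
  assumes p: "is_partition (-1) 1 N p" and p': "is_partition 0 emax N' p'"
    and f: "f \<in> tensor_space (pw_poly k N p) (pw_poly k' N' p')"
  shows "f \<in> L2_Omega emax"
proof -
  obtain s v w where f_eq: "f = (\<lambda>(\<mu>, \<epsilon>). \<Sum>l<(s::nat). v l \<mu> * w l \<epsilon>)"
    and vw: "\<And>l. l < s \<Longrightarrow> v l \<in> pw_poly k N p \<and> w l \<in> pw_poly k' N' p'"
    using f unfolding tensor_space_def by blast
  have "\<exists>g B. bounded_borel_version {-1..1} (v l) g B" if "l < s" for l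
    using pw_poly_bounded_borel[OF p] vw[OF that] by blast
  then obtain g B where g: "\<And>l. l < s \<Longrightarrow> bounded_borel_version {-1..1} (v l) (g l) (B l)"
    by metis
  note g = bounded_borel_versionD[OF g]
  have "\<exists>h C. bounded_borel_version {0..emax} (w l) h C" if "l < s" for l
    using pw_poly_bounded_borel[OF p'] vw[OF that] by blast
  then obtain h C where h: "\<And>l. l < s \<Longrightarrow> bounded_borel_version {0..emax} (w l) (h l) (C l)"
    by metis
  note h = bounded_borel_versionD[OF h]
  show ?thesis
  proof (rule L2_Omega_bounded_AE)
    show "(\<lambda>z. \<Sum>l<s. g l (fst z) * h l (snd z)) \<in> borel_measurable borel"
    proof (intro borel_measurable_sum borel_measurable_times)
      fix l assume "l \<in> {..<s}"
      then have [measurable]: "g l \<in> borel_measurable borel" "h l \<in> borel_measurable borel"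
        using g(1) h(1) by auto
      show "(\<lambda>z :: real \<times> real. g l (fst z)) \<in> borel_measurable borel"
        by (simp flip: borel_prod)
      show "(\<lambda>z :: real \<times> real. h l (snd z)) \<in> borel_measurable borel"
        by (simp flip: borel_prod)
    qed
    show "\<bar>\<Sum>l<s. g l (fst z) * h l (snd z)\<bar> \<le> (\<Sum>l<s. B l * C l)" for z
    proof -
      have "\<bar>g l (fst z) * h l (snd z)\<bar> \<le> B l * C l" if "l < s" for l
        unfolding abs_mult using g(2)[OF that] h(2)[OF that]
        by (intro mult_mono) (auto intro: order_trans[OF abs_ge_zero])
      then have "(\<Sum>l<s. \<bar>g l (fst z) * h l (snd z)\<bar>) \<le> (\<Sum>l<s. B l * C l)"
        by (intro sum_mono) auto
      then show ?thesis
        by (rule order_trans[OF sum_abs])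
    qed
    have "AE z in lborel. \<forall>l\<in>{..<s}. (fst z \<in> {-1..1} \<longrightarrow> v l (fst z) = g l (fst z)) \<and>
        (snd z \<in> {0..emax} \<longrightarrow> w l (snd z) = h l (snd z))"
    proof (intro AE_finite_allI AE_conjI)
      fix l assume "l \<in> {..<s}"
      then have l: "l < s" by simp
      show "AE z in (lborel :: (real \<times> real) measure). fst z \<in> {-1..1} \<longrightarrow> v l (fst z) = g l (fst z)"
        by (rule AE_lborel_fst[OF g(3)[OF l]])
      show "AE z in (lborel :: (real \<times> real) measure). snd z \<in> {0..emax} \<longrightarrow> w l (snd z) = h l (snd z)"
        by (rule AE_lborel_snd[OF h(3)[OF l]])
    qed auto
    then show "AE z in lborel. z \<in> Omega emax \<longrightarrow> f z = (\<Sum>l<s. g l (fst z) * h l (snd z))"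
      by eventually_elim (auto simp: f_eq Omega_def)
  qed
qed

text \<open>
  In Rodrigues' formula a polynomial of degree \<open>2 * d\<close> is differentiated \<open>d\<close> times.
\<close>

lemma degree_legendre_le: "degree (legendre d) \<le> d"
proof -
  have "degree ((pderiv ^^ j) q) = degree q - j" for j and q :: "real poly"
    by (induction j) (auto simp: degree_pderiv)
  moreover have "degree ([:-1, 0, 1 :: real:] ^ d) \<le> 2 * d"
    using degree_power_le[of "[:-1, 0, 1 :: real:]" d] by simp
  ultimately show ?thesis
    unfolding legendre_def by (intro order_trans[OF degree_smult_le]) simp
qed

lemma partition_mono:
  assumes "is_partition a b N p" "i \<le> j" "j \<le> N"
  shows "p i \<le> p j"
  using assms(2,3)
proof (induction j rule: dec_induct)
  case (step j)
  have "p j < p (Suc j)"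
    using assms(1) step.prems by (simp add: is_partition_def Suc_le_eq)
  then show ?case using step by simp
qed simp

text \<open>
  On its own cell a basis function is a Legendre polynomial composed with an affine map. On every
  other cell it vanishes, since the open cells of a partition are disjoint.
\<close>

lemma dg_basis_in_pw_poly:
  assumes p: "is_partition a b N p" and i: "i < (k + 1) * N"
  shows "dg_basis k p i \<in> pw_poly k N p"
  unfolding pw_poly_def
proof (intro CollectI allI impI)
  fix c assume c: "c < N"
  define c0 where "c0 = i div (k + 1)"
  define d where "d = i mod (k + 1)"
  have c0: "c0 < N"
    unfolding c0_def using i by (metis less_mult_imp_div_less mult.commute)
  have d: "d \<le> k"
    unfolding d_def by (metis Suc_eq_plus1 less_Suc_eq_le mod_less_divisor zero_less_Suc)
  show "\<exists>q. degree q \<le> k \<and> (\<forall>x\<in>{p c<..<p (Suc c)}. dg_basis k p i x = poly q x)"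
  proof (cases "c = c0")
    case True
    let ?a = "p c" and ?b = "p (Suc c)"
    let ?q = "Polynomial.smult (sqrt ((2 * real d + 1) / (?b - ?a)))
      (pcompose (legendre d) [:(- ?a - ?b) / (?b - ?a), 2 / (?b - ?a):])"
    have "degree (pcompose (legendre d) [:(- ?a - ?b) / (?b - ?a), 2 / (?b - ?a):]) \<le> d * 1"
      by (rule order_trans[OF degree_pcompose_le mult_mono[OF degree_legendre_le]]) auto
    then have "degree ?q \<le> k"
      using d by (intro order_trans[OF degree_smult_le]) simp
    moreover have "dg_basis k p i x = poly ?q x" if "x \<in> {?a<..<?b}" for x
    proof -
      have "poly [:(- ?a - ?b) / (?b - ?a), 2 / (?b - ?a):] x = (2 * x - ?a - ?b) / (?b - ?a)"
        by (simp add: diff_divide_distrib flip: minus_divide_left)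
      then show ?thesis
        using that unfolding dg_basis_def Let_def poly_smult poly_pcompose
          c0_def[symmetric] d_def[symmetric] True[symmetric] by simp
    qed
    ultimately show ?thesis by blast
  next
    case False
    then have "p (Suc c) \<le> p c0 \<or> p (Suc c0) \<le> p c"
      using partition_mono[OF p, of "Suc c" c0] partition_mono[OF p, of "Suc c0" c] c c0 by linarith
    then have "dg_basis k p i x = poly 0 x" if "x \<in> {p c<..<p (Suc c)}" for x
      using that by (auto simp: dg_basis_def Let_def c0_def)
    then show ?thesis by (intro exI[of _ 0]) simp
  qed
qed

lemma pw_poly_sum:
  assumes "\<And>j. j \<in> J \<Longrightarrow> v j \<in> pw_poly k N p" "finite J"
  shows "(\<lambda>x. \<Sum>j\<in>J. a j * v j x) \<in> pw_poly k N p"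
  unfolding pw_poly_def
proof (intro CollectI allI impI)
  fix c assume c: "c < N"
  then have "\<forall>j\<in>J. \<exists>q. degree q \<le> k \<and> (\<forall>x\<in>{p c<..<p (Suc c)}. v j x = poly q x)"
    using assms(1) unfolding pw_poly_def by blast
  then obtain q where q: "\<And>j. j \<in> J \<Longrightarrow> degree (q j) \<le> k"
      "\<And>j x. j \<in> J \<Longrightarrow> x \<in> {p c<..<p (Suc c)} \<Longrightarrow> v j x = poly (q j) x"
    by metis
  have "degree (\<Sum>j\<in>J. Polynomial.smult (a j) (q j)) \<le> k"
    using q(1) assms(2) by (intro degree_sum_le) (auto intro: order_trans[OF degree_smult_le])
  moreover have "(\<Sum>j\<in>J. a j * v j x) = poly (\<Sum>j\<in>J. Polynomial.smult (a j) (q j)) x"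
    if "x \<in> {p c<..<p (Suc c)}" for x
    using q(2) that by (simp add: poly_sum)
  ultimately show "\<exists>q. degree q \<le> k \<and> (\<forall>x\<in>{p c<..<p (Suc c)}. (\<Sum>j\<in>J. a j * v j x) = poly q x)"
    by blast
qed

text \<open>
  Multiplying out the bilinear form leaves, for each row \<open>i\<close> of the coefficient matrix, the product
  of the \<open>i\<close>-th basis function with a linear combination of the basis functions in the other
  variable.
\<close>

lemma coeff_fun_in_tensor_space:
  assumes p: "is_partition a b N p" and p': "is_partition a' b' N' p'"
    and M: "M \<in> carrier_mat ((k + 1) * N) ((k' + 1) * N')"
  shows "coeff_fun (dg_basis_vec k N p) (dg_basis_vec k' N' p') M
    \<in> tensor_space (pw_poly k N p) (pw_poly k' N' p')"
proof -
  let ?m = "(k + 1) * N" and ?n = "(k' + 1) * N'"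
  define w where "w i \<epsilon> = (\<Sum>j<?n. M $$ (i, j) * dg_basis k' p' j \<epsilon>)" for i \<epsilon>
  have "coeff_fun (dg_basis_vec k N p) (dg_basis_vec k' N' p') M =
      (\<lambda>(\<mu>, \<epsilon>). \<Sum>i<?m. dg_basis k p i \<mu> * w i \<epsilon>)"
    using M unfolding coeff_fun_def dg_basis_vec_def w_def
    by (auto simp: scalar_prod_def atLeast0LessThan fun_eq_iff intro!: sum.cong)
  moreover have "dg_basis k p i \<in> pw_poly k N p \<and> w i \<in> pw_poly k' N' p'" if "i < ?m" for i
    using dg_basis_in_pw_poly[OF p that] dg_basis_in_pw_poly[OF p']
    unfolding w_def by (auto intro!: pw_poly_sum)
  ultimately show ?thesis
    unfolding tensor_space_def by blast
qed

section \<open>Stability\<close>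

text \<open>
  The energy estimate: \<open>f\<close> lies in the Galerkin space \<open>V\<close>, whichever it is, and is tested with
  itself.
\<close>

lemma euler_galerkin_wnorm_le:
  assumes step: "euler_galerkin emax eta chi \<Delta>t V g f"
    and f: "f \<in> L2_Omega emax" and g: "g \<in> L2_Omega emax" and eta: "energy_fun eta \<in> L2_Omega emax"
    and chi: "chi \<in> borel_measurable (lebesgue_on {0..emax})"
    and bounds: "\<forall>\<epsilon>\<in>{0..emax}. chi_min \<le> chi \<epsilon> \<and> chi \<epsilon> \<le> chi_max"
    and pos: "chi_min > 0" "\<Delta>t > 0"
  shows "(1 + \<Delta>t * chi_min) * wnorm emax f \<le> wnorm emax g + \<Delta>t * wnorm emax (energy_fun eta)"
proof -
  have chi_bounds: "chi_min \<le> energy_fun chi z \<and> \<bar>energy_fun chi z\<bar> \<le> chi_max"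
    if "z \<in> Omega emax" for z
    using that bounds pos(1) by (force simp: Omega_def energy_fun_def)
  have chi_f: "(\<lambda>z. energy_fun chi z * f z) \<in> L2_Omega emax"
    using chi_bounds energy_fun_measurable[OF chi] f by (intro L2_Omega_bounded_mult[of _ _ chi_max]) auto
  \<comment> \<open>Integrability of the right-hand side matters here: without it that integral would be 0.\<close>
  have coercive: "chi_min * winner emax f f \<le> winner emax (\<lambda>z. energy_fun chi z * f z) f"
  proof -
    have "chi_min * winner emax f f = (\<integral>z. chi_min * (f z * f z) \<partial>Omega_measure emax)"
      unfolding winner_def by simp
    also have "\<dots> \<le> winner emax (\<lambda>z. energy_fun chi z * f z) f"
      unfolding winner_def mult.assoc
    proof (rule integral_mono)
      show "integrable (Omega_measure emax) (\<lambda>z. chi_min * (f z * f z))"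
        using integrable_mult_L2_Omega[OF f f] by simp
      show "integrable (Omega_measure emax) (\<lambda>z. energy_fun chi z * (f z * f z))"
        using integrable_mult_L2_Omega[OF chi_f f] by (simp add: mult.assoc)
    qed (use chi_bounds in \<open>auto intro!: mult_right_mono\<close>)
    finally show ?thesis .
  qed
  let ?f = "wnorm emax f" and ?rhs = "wnorm emax g + \<Delta>t * wnorm emax (energy_fun eta)"
  have "1 / \<Delta>t * winner emax (\<lambda>z. f z - g z) f = coll_form emax eta chi f f"
    using step unfolding euler_galerkin_def by blast
  then have "winner emax f f - winner emax g f = \<Delta>t * coll_form emax eta chi f f"
    using pos(2) winner_diff_left[OF f g f] by (simp add: field_simps)
  also have "\<dots> \<le> \<Delta>t * (winner emax (energy_fun eta) f - chi_min * winner emax f f)"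
    using coercive pos(2) unfolding coll_form_def by (intro mult_left_mono) auto
  finally have "(1 + \<Delta>t * chi_min) * winner emax f f
      \<le> winner emax g f + \<Delta>t * winner emax (energy_fun eta) f"
    by (simp add: algebra_simps)
  also have "\<dots> \<le> ?rhs * ?f"
    using winner_le_wnorm[OF g f] mult_left_mono[OF winner_le_wnorm[OF eta f] less_imp_le[OF pos(2)]]
    by (simp add: algebra_simps)
  \<comment> \<open>One factor \<open>?f\<close> is cancelled; if it is 0, the claim is \<open>0 \<le> ?rhs\<close>.\<close>
  finally have "((1 + \<Delta>t * chi_min) * ?f) * ?f \<le> ?rhs * ?f"
    by (simp add: wnorm_square[symmetric] power2_eq_square algebra_simps)
  moreover have "0 \<le> ?rhs"
    using pos(2) wnorm_nonneg by (intro add_nonneg_nonneg mult_nonneg_nonneg) auto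
  ultimately show ?thesis
    using wnorm_nonneg[of emax f] by (cases "?f = 0") auto
qed

text \<open>
  An orthogonal projection contracts: test its defining relation with the projection itself.
\<close>

lemma wnorm_projection_le:
  assumes "g \<in> V" "\<forall>w\<in>V. winner emax g w = winner emax f w"
    and "g \<in> L2_Omega emax" "f \<in> L2_Omega emax"
  shows "wnorm emax g \<le> wnorm emax f"
proof -
  have "wnorm emax g * wnorm emax g = winner emax f g"
    using assms(1,2) wnorm_square[of emax g] by (simp add: power2_eq_square)
  also have "\<dots> \<le> wnorm emax f * wnorm emax g"
    using assms(3,4) by (intro winner_le_wnorm)
  finally show ?thesis
    using wnorm_nonneg[of emax g] wnorm_nonneg[of emax f] by (cases "wnorm emax g = 0") auto
qed

text \<open>
  Each step is the map \<open>x \<mapsto> c * (x + \<tau> * h)\<close>, whose fixed point is \<open>h / \<kappa>\<close> because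
  \<open>c * \<tau> = (1 - c) / \<kappa>\<close>. The bound is the convex combination of \<open>a 0\<close> and that fixed point with
  weights \<open>c ^ t\<close> and \<open>1 - c ^ t\<close>.
\<close>

lemma implicit_euler_recursion:
  fixes a :: "nat \<Rightarrow> real"
  assumes step: "\<And>t. (1 + \<tau> * \<kappa>) * a (Suc t) \<le> a t + \<tau> * h" and pos: "\<kappa> > 0" "\<tau> > 0"
  defines "c \<equiv> 1 / (1 + \<tau> * \<kappa>)"
  shows "a t \<le> c ^ t * a 0 + 1 / \<kappa> * (1 - c ^ t) * h"
proof (induction t)
  case (Suc t)
  have q: "1 + \<tau> * \<kappa> > 0"
    using pos by (simp add: add_pos_pos)
  then have c: "c > 0" "c * \<tau> = 1 / \<kappa> * (1 - c)"
    using pos by (auto simp: c_def field_simps)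
  have "a (Suc t) \<le> c * (a t + \<tau> * h)"
    using step[of t] q by (simp add: c_def field_simps)
  also have "\<dots> \<le> c * (c ^ t * a 0 + 1 / \<kappa> * (1 - c ^ t) * h + \<tau> * h)"
    using Suc c(1) by (intro mult_left_mono) auto
  also have "\<dots> = c ^ Suc t * a 0 + (c * (1 / \<kappa> * (1 - c ^ t)) + c * \<tau>) * h"
    by (simp add: algebra_simps)
  also have "\<dots> = c ^ Suc t * a 0 + 1 / \<kappa> * (1 - c ^ Suc t) * h"
    unfolding c(2) using pos by (simp add: field_simps)
  finally show ?case .
qed simp

theorem lemma4p4:
  fixes emax chi_min chi_max \<Delta>t :: real
    and eta chi :: "real \<Rightarrow> real"
    and k N\<^sub>\<mu> N\<^sub>\<epsilon> m n r :: nat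
    and p\<^sub>\<mu> p\<^sub>\<epsilon> :: "nat \<Rightarrow> real"
    and X Y :: "real \<Rightarrow> real vec"
    and U S E :: "nat \<Rightarrow> real mat"
    and fhat :: "nat \<Rightarrow> real \<times> real \<Rightarrow> real"
    and f0 fh0 :: "real \<times> real \<Rightarrow> real"
  assumes "emax > 0"
    and "\<forall>\<epsilon>\<in>{0..emax}. eta \<epsilon> > 0"
    and "energy_fun eta \<in> L2_Omega emax"
    and "chi \<in> borel_measurable (lebesgue_on {0..emax})"
    and "chi_min > 0"
    and "\<forall>\<epsilon>\<in>{0..emax}. chi_min \<le> chi \<epsilon> \<and> chi \<epsilon> \<le> chi_max"
    and "is_partition (-1) 1 N\<^sub>\<mu> p\<^sub>\<mu>"
    and "is_partition 0 emax N\<^sub>\<epsilon> p\<^sub>\<epsilon>"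
    and "m = (k + 1) * N\<^sub>\<mu>"
    and "n = (k + 1) * N\<^sub>\<epsilon>"
    and "1 \<le> r"
    and "r \<le> min m n"
    and "X = dg_basis_vec k N\<^sub>\<mu> p\<^sub>\<mu>"
    and "Y = dg_basis_vec k N\<^sub>\<epsilon> p\<^sub>\<epsilon>"
    and "\<Delta>t > 0"
    and "dlr_dg_solution emax eta chi \<Delta>t m n r X Y U S E"
    and "\<forall>t. fhat t = coeff_fun X Y (U t * S t * transpose_mat (E t))"
    and "f0 \<in> L2_Omega emax"
    and "fh0 \<in> tensor_space (pw_poly k N\<^sub>\<mu> p\<^sub>\<mu>) (pw_poly k N\<^sub>\<epsilon> p\<^sub>\<epsilon>)"
    and "\<forall>w \<in> tensor_space (pw_poly k N\<^sub>\<mu> p\<^sub>\<mu>) (pw_poly k N\<^sub>\<epsilon> p\<^sub>\<epsilon>).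
           winner emax fh0 w = winner emax f0 w"
    and "wnorm emax (fhat 0) \<le> wnorm emax fh0"
  shows "let c = 1 / (1 + \<Delta>t * chi_min) in
           \<forall>t. wnorm emax (fhat (Suc t)) \<le>
                 c ^ (t + 1) * wnorm emax f0
                 + 1 / chi_min * (1 - c ^ (t + 1)) * wnorm emax (energy_fun eta)"
proof -
  let ?c = "1 / (1 + \<Delta>t * chi_min)" and ?h = "wnorm emax (energy_fun eta)"
  note partitions = assms(7,8) and sol = assms(16)[unfolded dlr_dg_solution_def]
  have step: "dlr_dg_step emax eta chi \<Delta>t m n r X Y (U t) (S t) (E t) (U (Suc t)) (S (Suc t)) (E (Suc t))" for t
    using sol by blast
  \<comment> \<open>The factors at time 0 have the right shape by the initial condition, later ones by the
    step that produced them.\<close>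
  have "U t \<in> carrier_mat m r \<and> S t \<in> carrier_mat r r \<and> E t \<in> carrier_mat n r" for t
    using sol step[of "t - 1"]
    by (cases t) (auto simp: orthonormal_factors_def dlr_dg_step_def Let_def)
  then have "U t * S t * transpose_mat (E t) \<in> carrier_mat m n" for t
    by (metis mult_carrier_mat transpose_carrier_mat)
  then have fhat_L2: "fhat t \<in> L2_Omega emax" for t
    using coeff_fun_in_tensor_space[OF partitions] tensor_space_subset_L2_Omega[OF partitions] assms(9,10,13,14,17)
    by metis
  have "euler_galerkin emax eta chi \<Delta>t (V0 r X Y (U (Suc t)) (E (Suc t))) (fhat t) (fhat (Suc t))" for t
    using step[of t] assms(17) by (simp add: dlr_dg_step_def Let_def)
  then have "(1 + \<Delta>t * chi_min) * wnorm emax (fhat (Suc t)) \<le> wnorm emax (fhat t) + \<Delta>t * ?h" for t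
    using euler_galerkin_wnorm_le fhat_L2 assms(3,4,5,6,15) by blast
  then have bound: "wnorm emax (fhat t) \<le>
      ?c ^ t * wnorm emax (fhat 0) + 1 / chi_min * (1 - ?c ^ t) * ?h" for t
    using implicit_euler_recursion[of \<Delta>t chi_min "\<lambda>t. wnorm emax (fhat t)"] assms(5,15) by blast
  have "wnorm emax fh0 \<le> wnorm emax f0"
    using wnorm_projection_le[OF assms(19,20) tensor_space_subset_L2_Omega[OF partitions assms(19)] assms(18)] .
  then have "wnorm emax (fhat 0) \<le> wnorm emax f0"
    using assms(21) by linarith
  then have "?c ^ t * wnorm emax (fhat 0) \<le> ?c ^ t * wnorm emax f0" for t
    using assms(5,15) by (intro mult_left_mono) auto
  then show ?thesis
    unfolding Let_def using bound by (smt (verit, best) Suc_eq_plus1)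
qed

end
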